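(* Let $F=\{1^{r}0^{s}1^{t}0^{k} : r,s,t,k\geq 1 \text{ integers}\}$. For every $f=1^r0^s1^t0^k\in F$, the quadruple $(r,s,t,k)$ or the quadruple $(k,t,s,r)$ (the one of the complement of the reverse of $f$, which has the same index as $f$) satisfies at least one of the conditions (1)--(15) below; and whenever $f=1^{r}0^{s}1^{t}0^{k}\in F$ satisfies one of these conditions, its index $B(f)$ has the value given there. (1) $r=1$, $t\geq 1$, $s\geq 1$, $k=s+1$: $B(f)=+\infty$. (2) $r=1$, $t=1$, $s=k$, $k\geq 1$: $B(f)=+\infty$. (3) $r=1$, $t\geq 2$, $s=k+1$, $k\geq 1$: $B(f)=+\infty$. (4) $r=1$, $t=2$, $s\geq k+2$, $k\geq 2$: $B(f)=+\infty$. (5) $r\geq t+3$, $t\geq 1$, $s\geq 3$, $k=2$: $B(f)=2r+2s+t+2$. (6) $r=t+2$, $t\geq 1$, $s\geq 2$, $s\geq k\geq 1$: $B(f)=3t+2s+k+2$. (7) [$r\geq t+3$, $t\geq 1$, $s\geq 3$, $k=1$] or [$r=t+2$, $t\geq 1$, $s=1$, $k=1$] or [$r=t+2$, $t\geq 1$, $s\geq 2$, $k=s+1$]: $B(f)=2r+2s+t+k-1$. (8) [$r=t+1$, $t\geq 2$, $s\geq 1$, $k=s+1$] or [$r=2$, $t=1$, $s\geq 1$, $k\geq s+1$] or [$r\geq 3$, $t=1$, $s=1$, $k\geq 3$]: $B(f)=r+2s+2t+k$. (9) $r=1$, $t=1$, $s\geq 1$, $k\geq s+3$: $B(f)=2s+k+4$.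 (10) $r=1$, $t=1$, $s\geq k+1$, $k\geq 1$: $B(f)=2k+s+3$. (11) $r\geq 2$, $t=r$, $s\geq k+1$, $k\geq 1$: $B(f)=3r+2s+k-1$. (12) $r\geq 1$, $t\geq r+2$, $s\geq k+2$, $k\geq 1$: $B(f)=2s+2t+r+k-2$. (13) $1\leq r\leq 2$, $t=2$, $s\geq 1$, $k\geq s+3$: $B(f)=2s+k+r+4$. (14) $k\geq s+3$ and one of: [$r\geq 3$, $t=2$, $s\geq 1$], [$r=3$, $t=1$, $s\geq 2$], [$r\geq t$, $t\geq 3$, $s\geq 1$], [$r\geq 3$, $t\geq r+1$, $s\geq 1$]: $B(f)=2(r+s+t+k-1)$. (15) [$r\geq 2$, $t=r+1$, $s\geq k+1$, $k\geq 2$] or [$r=t+1$, $t\geq 1$, $s\geq k$, $k\geq 2$] or [$r=t+2$, $t\geq 1$, $s\geq 2$, $k=s+2$] or [$r=t$, $t\geq 2$, $s\geq 2$, $k=s$]: $B(f)=r+2s+2t+k+2$.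
   Context: All strings are binary; $1^a$ (resp. $0^a$) denotes the string of $a$ consecutive ones (resp. zeros), and juxtaposition is concatenation. $Q_d$ is the $d$-dimensional hypercube: its vertices are the binary strings of length $d$, two being adjacent iff they differ in exactly one bit. A string $f$ is a factor of $\mu$ if $f$ appears as $|f|$ consecutive bits of $\mu$. The generalized Fibonacci cube $Q_d(f)$ is the subgraph of $Q_d$ induced by all strings of length $d$ that do not contain $f$ as a factor. A subgraph $H$ of a connected graph $G$ is an isometric subgraph, written $H\hookrightarrow G$, if $d_H(\mu,\nu)=d_G(\mu,\nu)$ for all $\mu,\nu\in V(H)$ (with $d_H=\infty$ for vertices in different components of $H$). The index $B(f)$ is the smallest integer $d\geq 1$ such that $Q_d(f)\not\hookrightarrow Q_d$, and $B(f)=+\infty$ if no such $d$ exists. The reverse of $a_1a_2\cdots a_m$ is $a_m\cdots a_2a_1$; the complement replaces each bit $a$ by $1-a$. Reversal and complementation of $f$ give isomorphic graphs $Q_d(f)$ and preserve the index; the complement of the reverse of $1^r0^s1^t0^k$ is $1^k0^t1^s0^r$. *)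

theory Defs
  imports
    "Graph_Theory.Graph_Theory"
    "HOL-Library.Sublist"
    "HOL-Library.Extended_Nat"
begin

text \<open>
  Binary strings are values of type \<^typ>\<open>bool list\<close>, with \<^const>\<open>True\<close> as the bit 1 and
  \<^const>\<open>False\<close> as the bit 0; being a factor is \<^const>\<open>sublist\<close>. As usual in \<open>Graph_Theory\<close>,
  an undirected graph is a symmetric digraph.
\<close>

definition hypercube :: "nat \<Rightarrow> bool list pair_pre_digraph" where
  "hypercube d =
    \<lparr> pverts = {u. length u = d},
      parcs = {(u, v). length u = d \<and> length v = d \<and> card {i. i < d \<and> u ! i \<noteq> v ! i} = 1} \<rparr>"

definition fib_cube :: "nat \<Rightarrow> bool list \<Rightarrow> (bool list, bool list \<times> bool list) pre_digraph" where
  "fib_cube d f =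
    with_proj (hypercube d) \<restriction> {u \<in> pverts (hypercube d). \<not> sublist f u}"

text \<open>
  The distance is the library's shortest-path distance for unit arc weights; it is \<open>\<infinity>\<close> for
  vertices in different components, being an infimum over an empty set of walks in \<^typ>\<open>ereal\<close>.
\<close>

definition graph_dist :: "('a, 'b) pre_digraph \<Rightarrow> 'a \<Rightarrow> 'a \<Rightarrow> ereal" where
  "graph_dist G u v = wf_digraph.\<mu> G (\<lambda>_. 1) u v"

definition isometric_subgraph :: "('a, 'b) pre_digraph \<Rightarrow> ('a, 'b) pre_digraph \<Rightarrow> bool" where
  "isometric_subgraph H G \<longleftrightarrow>
    subgraph H G \<and> (\<forall>u \<in> verts H. \<forall>v \<in> verts H. graph_dist H u v = graph_dist G u v)"

text \<open>On \<^typ>\<open>enat\<close> the infimum of a nonempty set is its minimum, and that of the empty set is \<open>\<infinity>\<close>.\<close>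

definition cube_index :: "bool list \<Rightarrow> enat" where
  "cube_index f =
    Inf (enat ` {d. d \<ge> 1 \<and> \<not> isometric_subgraph (fib_cube d f) (with_proj (hypercube d))})"

definition four_blocks :: "nat \<Rightarrow> nat \<Rightarrow> nat \<Rightarrow> nat \<Rightarrow> bool list" where
  "four_blocks r s t k =
    replicate r True @ replicate s False @ replicate t True @ replicate k False"

definition cond1 :: "nat \<Rightarrow> nat \<Rightarrow> nat \<Rightarrow> nat \<Rightarrow> bool" where
  "cond1 r s t k \<longleftrightarrow> r = 1 \<and> t \<ge> 1 \<and> s \<ge> 1 \<and> k = s + 1"

definition cond2 :: "nat \<Rightarrow> nat \<Rightarrow> nat \<Rightarrow> nat \<Rightarrow> bool" where
  "cond2 r s t k \<longleftrightarrow> r = 1 \<and> t = 1 \<and> s = k \<and> k \<ge> 1"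

definition cond3 :: "nat \<Rightarrow> nat \<Rightarrow> nat \<Rightarrow> nat \<Rightarrow> bool" where
  "cond3 r s t k \<longleftrightarrow> r = 1 \<and> t \<ge> 2 \<and> s = k + 1 \<and> k \<ge> 1"

definition cond4 :: "nat \<Rightarrow> nat \<Rightarrow> nat \<Rightarrow> nat \<Rightarrow> bool" where
  "cond4 r s t k \<longleftrightarrow> r = 1 \<and> t = 2 \<and> s \<ge> k + 2 \<and> k \<ge> 2"

definition cond5 :: "nat \<Rightarrow> nat \<Rightarrow> nat \<Rightarrow> nat \<Rightarrow> bool" where
  "cond5 r s t k \<longleftrightarrow> r \<ge> t + 3 \<and> t \<ge> 1 \<and> s \<ge> 3 \<and> k = 2"

definition cond6 :: "nat \<Rightarrow> nat \<Rightarrow> nat \<Rightarrow> nat \<Rightarrow> bool" where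
  "cond6 r s t k \<longleftrightarrow> r = t + 2 \<and> t \<ge> 1 \<and> s \<ge> 2 \<and> s \<ge> k \<and> k \<ge> 1"

definition cond7 :: "nat \<Rightarrow> nat \<Rightarrow> nat \<Rightarrow> nat \<Rightarrow> bool" where
  "cond7 r s t k \<longleftrightarrow>
    (r \<ge> t + 3 \<and> t \<ge> 1 \<and> s \<ge> 3 \<and> k = 1) \<or>
    (r = t + 2 \<and> t \<ge> 1 \<and> s = 1 \<and> k = 1) \<or>
    (r = t + 2 \<and> t \<ge> 1 \<and> s \<ge> 2 \<and> k = s + 1)"

definition cond8 :: "nat \<Rightarrow> nat \<Rightarrow> nat \<Rightarrow> nat \<Rightarrow> bool" where
  "cond8 r s t k \<longleftrightarrow>
    (r = t + 1 \<and> t \<ge> 2 \<and> s \<ge> 1 \<and> k = s + 1) \<or>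
    (r = 2 \<and> t = 1 \<and> s \<ge> 1 \<and> k \<ge> s + 1) \<or>
    (r \<ge> 3 \<and> t = 1 \<and> s = 1 \<and> k \<ge> 3)"

definition cond9 :: "nat \<Rightarrow> nat \<Rightarrow> nat \<Rightarrow> nat \<Rightarrow> bool" where
  "cond9 r s t k \<longleftrightarrow> r = 1 \<and> t = 1 \<and> s \<ge> 1 \<and> k \<ge> s + 3"

definition cond10 :: "nat \<Rightarrow> nat \<Rightarrow> nat \<Rightarrow> nat \<Rightarrow> bool" where
  "cond10 r s t k \<longleftrightarrow> r = 1 \<and> t = 1 \<and> s \<ge> k + 1 \<and> k \<ge> 1"

definition cond11 :: "nat \<Rightarrow> nat \<Rightarrow> nat \<Rightarrow> nat \<Rightarrow> bool" where
  "cond11 r s t k \<longleftrightarrow> r \<ge> 2 \<and> t = r \<and> s \<ge> k + 1 \<and> k \<ge> 1"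

definition cond12 :: "nat \<Rightarrow> nat \<Rightarrow> nat \<Rightarrow> nat \<Rightarrow> bool" where
  "cond12 r s t k \<longleftrightarrow> r \<ge> 1 \<and> t \<ge> r + 2 \<and> s \<ge> k + 2 \<and> k \<ge> 1"

definition cond13 :: "nat \<Rightarrow> nat \<Rightarrow> nat \<Rightarrow> nat \<Rightarrow> bool" where
  "cond13 r s t k \<longleftrightarrow> 1 \<le> r \<and> r \<le> 2 \<and> t = 2 \<and> s \<ge> 1 \<and> k \<ge> s + 3"

definition cond14 :: "nat \<Rightarrow> nat \<Rightarrow> nat \<Rightarrow> nat \<Rightarrow> bool" where
  "cond14 r s t k \<longleftrightarrow> k \<ge> s + 3 \<and>
    ((r \<ge> 3 \<and> t = 2 \<and> s \<ge> 1) \<or>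
     (r = 3 \<and> t = 1 \<and> s \<ge> 2) \<or>
     (r \<ge> t \<and> t \<ge> 3 \<and> s \<ge> 1) \<or>
     (r \<ge> 3 \<and> t \<ge> r + 1 \<and> s \<ge> 1))"

definition cond15 :: "nat \<Rightarrow> nat \<Rightarrow> nat \<Rightarrow> nat \<Rightarrow> bool" where
  "cond15 r s t k \<longleftrightarrow>
    (r \<ge> 2 \<and> t = r + 1 \<and> s \<ge> k + 1 \<and> k \<ge> 2) \<or>
    (r = t + 1 \<and> t \<ge> 1 \<and> s \<ge> k \<and> k \<ge> 2) \<or>
    (r = t + 2 \<and> t \<ge> 1 \<and> s \<ge> 2 \<and> k = s + 2) \<or>
    (r = t \<and> t \<ge> 2 \<and> s \<ge> 2 \<and> k = s)"

definition some_cond :: "nat \<Rightarrow> nat \<Rightarrow> nat \<Rightarrow> nat \<Rightarrow> bool" where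
  "some_cond r s t k \<longleftrightarrow>
    cond1 r s t k \<or> cond2 r s t k \<or> cond3 r s t k \<or> cond4 r s t k \<or> cond5 r s t k \<or>
    cond6 r s t k \<or> cond7 r s t k \<or> cond8 r s t k \<or> cond9 r s t k \<or> cond10 r s t k \<or>
    cond11 r s t k \<or> cond12 r s t k \<or> cond13 r s t k \<or> cond14 r s t k \<or> cond15 r s t k"

end

theory Submission
  imports Defs
begin

text \<open>
  Call \<open>m\<close> a two-error shift of \<open>f\<close> if \<open>f\<close> and its translate by \<open>m\<close> disagree in exactly two
  positions of their overlap. If \<open>Q\<^sub>d(f)\<close> is not isometric, then there are \<open>f\<close>-free words
  \<open>u \<noteq> v\<close> such that every flip of a bit of \<open>u\<close> towards \<open>v\<close> creates a copy of \<open>f\<close>. Two of these copies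
  contain both of the flipped positions, which makes their distance a two-error shift \<open>m\<close> with
  \<open>|f| + m \<le> d\<close>. Conversely, for a two-error shift \<open>m\<close>, two copies of \<open>f\<close> at distance \<open>m\<close> can be
  glued, with one of the two disagreements blamed on each copy, to a word of length \<open>|f| + m\<close>; exchanging
  the roles of the disagreements gives the second word of a pair as above. The glued words are
  \<open>f\<close>-free as soon as every shift up to \<open>m / 2\<close> has at least three errors, because a third copy of \<open>f\<close>
  would yield two shifts with at most one error whose sum is \<open>m\<close>. Hence \<open>B(f) = |f| + m\<close> for the least
  two-error shift \<open>m\<close> whenever this holds, and \<open>B(f) = \<infinity>\<close> if there is no two-error shift. For
  four-block words the number of errors of a shift is a piecewise linear function, and the least
  two-error shift satisfies the condition in all of the cases (5)--(15).
\<close>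

section \<open>Distances in induced subgraphs of the hypercube\<close>

definition diffs :: "'a list \<Rightarrow> 'a list \<Rightarrow> nat set" where
  "diffs u v = {i. i < length u \<and> u ! i \<noteq> v ! i}"

lemma finite_diffs [simp]: "finite (diffs u v)"
  by (simp add: diffs_def)

lemma diffs_empty_iff: "length u = length v \<Longrightarrow> diffs u v = {} \<longleftrightarrow> u = v"
  by (auto simp: diffs_def intro: nth_equalityI)

lemma diffs_update:
  "i \<in> diffs u v \<Longrightarrow> diffs (u[i := v ! i]) v = diffs u v - {i}"
  by (auto simp: diffs_def nth_list_update split: if_splits)

lemma card_diffs_triangle:
  assumes "length u = length w"
  shows "card (diffs u v) \<le> card (diffs u w) + card (diffs w v)"
proof -
  have "diffs u v \<subseteq> diffs u w \<union> diffs w v"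
    using assms by (auto simp: diffs_def)
  then have "card (diffs u v) \<le> card (diffs u w \<union> diffs w v)"
    by (intro card_mono) auto
  then show ?thesis
    using card_Un_le[of "diffs u w" "diffs w v"] by linarith
qed

text \<open>Both the whole cube and the Fibonacci cube have this form, so the distance lemmas are
  proved once for an arbitrary \<open>S\<close>.\<close>

abbreviation induced_cube :: "nat \<Rightarrow> bool list set \<Rightarrow> (bool list, bool list \<times> bool list) pre_digraph" where
  "induced_cube d S \<equiv> with_proj (hypercube d) \<restriction> S"

lemma parcs_hypercube_iff:
  "(u, v) \<in> parcs (hypercube d) \<longleftrightarrow> length u = d \<and> length v = d \<and> card (diffs u v) = 1"
  by (auto simp: hypercube_def diffs_def)

lemma induced_cube_pverts: "induced_cube d (pverts (hypercube d)) = with_proj (hypercube d)"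
  by (auto simp: induce_subgraph_def with_proj_def hypercube_def)

lemma wf_induced_cube: "wf_digraph (induced_cube d S)"
  by (simp add: wf_digraph_def)

text \<open>One arc changes one bit, so by the triangle inequality every arc removes at most one
  difference to \<open>v\<close>.\<close>

lemma card_diffs_le_walk:
  assumes "pre_digraph.awalk (induced_cube d S) u p v" and "S \<subseteq> pverts (hypercube d)"
  shows "card (diffs u v) \<le> length p"
proof -
  interpret wf_digraph "induced_cube d S"
    by (rule wf_induced_cube)
  show ?thesis
    using assms(1)
  proof (induction p arbitrary: u)
    case Nil
    then show ?case by (simp add: awalk_Nil_iff diffs_def)
  next
    case (Cons a p)
    then obtain w where a: "a = (u, w)" "a \<in> parcs (hypercube d)" and "awalk w p v"
      by (cases a) (auto simp: awalk_Cons_iff)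
    then have "card (diffs u v) \<le> 1 + card (diffs w v)"
      using card_diffs_triangle[of u w v] by (simp add: parcs_hypercube_iff)
    also have "\<dots> \<le> length (a # p)"
      using Cons.IH[OF \<open>awalk w p v\<close>] by simp
    finally show ?case .
  qed
qed

text \<open>Greedy descent: \<open>step\<close> always offers a flip towards \<open>v\<close> that
  stays in \<open>S\<close> and lowers the number of differences by one, so induction on that number
  builds the walk.\<close>

lemma geodesic_walk_exists:
  assumes "S \<subseteq> pverts (hypercube d)"
    and step: "\<And>u v. u \<in> S \<Longrightarrow> v \<in> S \<Longrightarrow> u \<noteq> v \<Longrightarrow> \<exists>i\<in>diffs u v. u[i := v ! i] \<in> S"
    and "u \<in> S" "v \<in> S"
  shows "\<exists>p. pre_digraph.awalk (induced_cube d S) u p v \<and> length p = card (diffs u v)"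
proof -
  interpret wf_digraph "induced_cube d S"
    by (rule wf_induced_cube)
  have len: "length u = d" if "u \<in> S" for u
    using that assms(1) by (auto simp: hypercube_def)
  show ?thesis
    using \<open>u \<in> S\<close>
  proof (induction "card (diffs u v)" arbitrary: u)
    case 0
    then have "u = v"
      using len \<open>v \<in> S\<close> diffs_empty_iff[of u v] by simp
    then show ?case
      using 0 by (intro exI[of _ "[]"]) (simp add: awalk_Nil_iff)
  next
    case (Suc n)
    then have "u \<noteq> v"
      using diffs_empty_iff[of u v] by auto
    then obtain i where i: "i \<in> diffs u v" and S: "u[i := v ! i] \<in> S"
      using step Suc.prems \<open>v \<in> S\<close> by blast
    have "n = card (diffs (u[i := v ! i]) v)"
      using i Suc.hyps(2) by (simp add: diffs_update)
    then obtain p where p: "awalk (u[i := v ! i]) p v" "length p = n"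
      using Suc.hyps(1) S by metis
    have "diffs u (u[i := v ! i]) = {i}"
      using i by (auto simp: diffs_def nth_list_update split: if_splits)
    then have "awalk u ((u, u[i := v ! i]) # p) v"
      using p S Suc.prems len by (simp add: awalk_Cons_iff parcs_hypercube_iff)
    then show ?case
      using p Suc.hyps(2) by (metis length_Cons)
  qed
qed

lemma graph_dist_induced_cube:
  "graph_dist (induced_cube d S) u v =
    (INF p\<in>{p. pre_digraph.awalk (induced_cube d S) u p v}. ereal (length p))"
proof -
  interpret wf_digraph "induced_cube d S"
    by (rule wf_induced_cube)
  have "awalk_cost (\<lambda>_. 1) p = length p" for p :: "(bool list \<times> bool list) list"
    by (induction p) auto
  then show ?thesis
    by (simp add: graph_dist_def \<mu>_def)
qed

text \<open>The greedy walk attains the lower bound that holds for every walk.\<close>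

lemma graph_dist_eq_card_diffs:
  assumes "S \<subseteq> pverts (hypercube d)"
    and "\<And>u v. u \<in> S \<Longrightarrow> v \<in> S \<Longrightarrow> u \<noteq> v \<Longrightarrow> \<exists>i\<in>diffs u v. u[i := v ! i] \<in> S"
    and "u \<in> S" "v \<in> S"
  shows "graph_dist (induced_cube d S) u v = ereal (card (diffs u v))"
proof -
  obtain p where "pre_digraph.awalk (induced_cube d S) u p v" "length p = card (diffs u v)"
    using geodesic_walk_exists[OF assms] by blast
  then show ?thesis
    unfolding graph_dist_induced_cube
    by (intro antisym INF_greatest INF_lower2[of p]) (auto dest: card_diffs_le_walk[OF _ assms(1)])
qed

lemma graph_dist_hypercube:
  assumes "length u = d" "length v = d"
  shows "graph_dist (with_proj (hypercube d)) u v = ereal (card (diffs u v))"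
proof -
  have "\<exists>i\<in>diffs u v. u[i := v ! i] \<in> pverts (hypercube d)"
    if "u \<in> pverts (hypercube d)" "v \<in> pverts (hypercube d)" "u \<noteq> v" for u v
    using that diffs_empty_iff[of u v] by (auto simp: hypercube_def)
  from graph_dist_eq_card_diffs[OF order_refl this] show ?thesis
    using assms by (simp add: induced_cube_pverts) (simp add: hypercube_def)
qed

section \<open>Pairs of words obstructing isometry\<close>

text \<open>The pairs at which greedy descent from \<open>u\<close> to \<open>v\<close> is stuck.
  Blocking is required on the side of \<open>u\<close> only: this already rules out the first arc of
  every geodesic.\<close>

definition blocked_pair :: "nat \<Rightarrow> bool list \<Rightarrow> bool list \<Rightarrow> bool list \<Rightarrow> bool" where
  "blocked_pair d f u v \<longleftrightarrow> length u = d \<and> length v = d \<and> u \<noteq> v \<and>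
     \<not> sublist f u \<and> \<not> sublist f v \<and> (\<forall>i\<in>diffs u v. sublist f (u[i := v ! i]))"

text \<open>The first arc of a walk avoiding \<open>f\<close> cannot flip a bit towards
  \<open>v\<close>, so it brings the walk no closer to \<open>v\<close> and is one arc too
  many.\<close>

lemma blocked_pair_graph_dist:
  assumes "blocked_pair d f u v"
  shows "graph_dist (fib_cube d f) u v > ereal (card (diffs u v))"
proof -
  define S where "S = {u \<in> pverts (hypercube d). \<not> sublist f u}"
  interpret wf_digraph "induced_cube d S"
    by (rule wf_induced_cube)
  have walk: "card (diffs u v) + 1 \<le> length p" if p: "awalk u p v" for p
  proof (cases p)
    case Nil
    then show ?thesis
      using p assms by (simp add: awalk_Nil_iff blocked_pair_def)
  next
    case (Cons a q)
    then obtain w where w: "card (diffs u w) = 1" "length u = d" "length w = d" "w \<in> S"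
      and q: "awalk w q v"
      using p by (cases a) (auto simp: awalk_Cons_iff parcs_hypercube_iff)
    obtain i where "diffs u w = {i}"
      using w(1) by (auto simp: card_1_singleton_iff)
    then have i: "i < d" "w ! i \<noteq> u ! i"
      using w by (auto simp: diffs_def set_eq_iff)
    have eq: "w ! j = u ! j" if "j < d" "j \<noteq> i" for j
      using w that \<open>diffs u w = {i}\<close> by (auto simp: diffs_def set_eq_iff)
    have "card (diffs u v) \<le> card (diffs w v)"
    proof (rule card_mono)
      show "diffs u v \<subseteq> diffs w v"
      proof
        fix j assume j: "j \<in> diffs u v"
        have "j \<noteq> i"
        proof
          assume "j = i"
          then have "w = u[i := v ! i]"
            using w i eq j by (intro nth_equalityI) (auto simp: diffs_def nth_list_update)
          then show False
            using assms j \<open>j = i\<close> w(4) by (auto simp: S_def blocked_pair_def)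
        qed
        then show "j \<in> diffs w v"
          using j eq w by (auto simp: diffs_def)
      qed
    qed simp
    then show ?thesis
      using card_diffs_le_walk[OF q] Cons by (auto simp: S_def)
  qed
  \<comment> \<open>The bound is uniform in \<open>p\<close>, so the surplus of one survives the
    infimum; if there is no walk, the infimum is \<infinity>.\<close>
  have "ereal (card (diffs u v) + 1) \<le> graph_dist (induced_cube d S) u v"
    unfolding graph_dist_induced_cube using walk by (intro INF_greatest) force
  then show ?thesis
    unfolding fib_cube_def S_def[symmetric]
    by (rule order.strict_trans2[rotated]) simp
qed

text \<open>Without blocked pairs greedy descent never gets stuck, and all distances are Hamming
  distances; a blocked pair is itself a pair at too large a distance.\<close>

lemma isometric_iff_no_blocked_pair:
  "isometric_subgraph (fib_cube d f) (with_proj (hypercube d)) \<longleftrightarrow> \<not> (\<exists>u v. blocked_pair d f u v)"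
proof -
  define S where "S = {u \<in> pverts (hypercube d). \<not> sublist f u}"
  have H: "fib_cube d f = induced_cube d S"
    by (simp add: fib_cube_def S_def)
  have S: "u \<in> S \<longleftrightarrow> length u = d \<and> \<not> sublist f u" for u
    by (auto simp: S_def hypercube_def)
  have "S \<subseteq> pverts (hypercube d)"
    by (auto simp: S_def)
  moreover have "wf_digraph (with_proj (hypercube d))"
    using wf_induced_cube[of d "pverts (hypercube d)"] by (simp add: induced_cube_pverts)
  ultimately have sub: "subgraph (induced_cube d S) (with_proj (hypercube d))"
    using wf_induced_cube by (auto simp: subgraph_def compatible_def)
  show ?thesis
  proof
    assume iso: "isometric_subgraph (fib_cube d f) (with_proj (hypercube d))"
    have False if "blocked_pair d f u v" for u v
    proof -
      have "u \<in> S" "v \<in> S" and len: "length u = d" "length v = d"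
        using that by (auto simp: S blocked_pair_def)
      then have "graph_dist (fib_cube d f) u v = graph_dist (with_proj (hypercube d)) u v"
        using iso by (auto simp: isometric_subgraph_def H)
      then show False
        using blocked_pair_graph_dist[OF that] len by (simp add: graph_dist_hypercube)
    qed
    then show "\<not> (\<exists>u v. blocked_pair d f u v)" by blast
  next
    assume none: "\<not> (\<exists>u v. blocked_pair d f u v)"
    have step: "\<exists>i\<in>diffs u v. u[i := v ! i] \<in> S" if "u \<in> S" "v \<in> S" "u \<noteq> v" for u v
      using none that unfolding S blocked_pair_def by (metis length_list_update)
    have "graph_dist (induced_cube d S) u v = graph_dist (with_proj (hypercube d)) u v"
      if "u \<in> S" "v \<in> S" for u v
      using graph_dist_eq_card_diffs[OF \<open>S \<subseteq> _\<close> step that] that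
      by (simp add: graph_dist_hypercube S)
    then show "isometric_subgraph (fib_cube d f) (with_proj (hypercube d))"
      using sub by (simp add: isometric_subgraph_def H)
  qed
qed

section \<open>Two-error shifts\<close>

lemma sublist_iff_nth:
  "sublist f u \<longleftrightarrow> (\<exists>x. x + length f \<le> length u \<and> (\<forall>q<length f. u ! (x + q) = f ! q))"
proof
  assume "sublist f u"
  then obtain ps ss where "u = ps @ f @ ss"
    by (auto simp: sublist_def)
  then show "\<exists>x. x + length f \<le> length u \<and> (\<forall>q<length f. u ! (x + q) = f ! q)"
    by (intro exI[of _ "length ps"]) (auto simp: nth_append)
next
  assume "\<exists>x. x + length f \<le> length u \<and> (\<forall>q<length f. u ! (x + q) = f ! q)"
  then obtain x where x: "x + length f \<le> length u" "\<And>q. q < length f \<Longrightarrow> u ! (x + q) = f ! q"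
    by blast
  then have "f = take (length f) (drop x u)"
    by (intro nth_equalityI) auto
  then show "sublist f u"
    by (metis append_take_drop_id sublist_def)
qed

text \<open>With copies of \<open>f\<close> placed at \<open>0\<close> and at \<open>m\<close>, the
  two letters compared here meet at position \<open>x + m\<close> of the word; \<open>x\<close> is
  the coordinate in the right copy.\<close>

definition shift_errors :: "'a list \<Rightarrow> nat \<Rightarrow> nat set" where
  "shift_errors f m = {x. x + m < length f \<and> f ! x \<noteq> f ! (x + m)}"

lemma finite_shift_errors [simp]: "finite (shift_errors f m)"
  by (rule finite_subset[of _ "{..<length f}"]) (auto simp: shift_errors_def)

text \<open>On the overlap of the two windows both modified words spell out \<open>f\<close>, and
  they differ from each other exactly at \<open>i\<close> and \<open>j\<close>, which both lie in
  the overlap.\<close>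

lemma shift_errors_of_two_windows:
  fixes f u :: "bool list"
  assumes "length u = d" "x < y" "y + length f \<le> d" "i \<noteq> j" "i < d" "j < d"
    and fx: "\<And>q. q < length f \<Longrightarrow> u[i := \<not> u ! i] ! (x + q) = f ! q"
    and fy: "\<And>q. q < length f \<Longrightarrow> u[j := \<not> u ! j] ! (y + q) = f ! q"
    and "y \<le> i" "i < x + length f" "y \<le> j" "j < x + length f"
  shows "card (shift_errors f (y - x)) = 2"
proof -
  have "shift_errors f (y - x) = {i - y, j - y}"
  proof (rule set_eqI)
    fix z
    show "z \<in> shift_errors f (y - x) \<longleftrightarrow> z \<in> {i - y, j - y}"
    proof (cases "z + (y - x) < length f")
      case True
      have "x + (z + (y - x)) = y + z"
        using \<open>x < y\<close> by simp
      then have "f ! (z + (y - x)) = u[i := \<not> u ! i] ! (y + z)"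
        using fx[OF True] by metis
      moreover have "f ! z = u[j := \<not> u ! j] ! (y + z)"
        using fy[of z] True by simp
      moreover have "y + z < length u"
        using True \<open>x < y\<close> \<open>y + length f \<le> d\<close> \<open>length u = d\<close> by linarith
      \<comment> \<open>The letters differ when exactly one of the two flips hits position
        \<open>y + z\<close>.\<close>
      ultimately have "f ! (z + (y - x)) \<noteq> f ! z \<longleftrightarrow> (i = y + z) \<noteq> (j = y + z)"
        by (cases "i = y + z"; cases "j = y + z") simp_all
      then have "z \<in> shift_errors f (y - x) \<longleftrightarrow> (i = y + z) \<noteq> (j = y + z)"
        using True by (auto simp: shift_errors_def)
      then show ?thesis
        using \<open>i \<noteq> j\<close> \<open>y \<le> i\<close> \<open>y \<le> j\<close> by auto
    next
      case False
      then have "z \<noteq> i - y" "z \<noteq> j - y"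
        using assms(2,9-12) by linarith+
      then show ?thesis
        using False by (simp add: shift_errors_def)
    qed
  qed
  moreover have "i - y \<noteq> j - y"
    using \<open>i \<noteq> j\<close> \<open>y \<le> i\<close> \<open>y \<le> j\<close> by linarith
  ultimately show ?thesis
    by simp
qed

text \<open>Each difference \<open>i\<close> gets a window \<open>w i\<close>, where flipping bit
  \<open>i\<close> creates \<open>f\<close>. The aim is a pair of consecutive differences whose
  windows both contain both of them.\<close>

lemma blocked_pair_imp_two_errors:
  assumes "blocked_pair d f u v"
  shows "\<exists>m\<ge>1. card (shift_errors f m) = 2 \<and> length f + m \<le> d"
proof -
  define n where "n = length f"
  define D where "D = diffs u v"
  have len: "length u = d" "length v = d" and "u \<noteq> v" "\<not> sublist f u" "\<not> sublist f v"
    and blocked: "\<And>i. i \<in> D \<Longrightarrow> sublist f (u[i := v ! i])"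
    using assms by (auto simp: blocked_pair_def D_def)
  have D: "i \<in> D \<longleftrightarrow> i < d \<and> v ! i = (\<not> u ! i)" for i
    using len by (auto simp: D_def diffs_def)
  have [simp]: "finite D" by (simp add: D_def)
  have "D \<noteq> {}"
    using \<open>u \<noteq> v\<close> len diffs_empty_iff[of u v] by (simp add: D_def)
  have "\<forall>i\<in>D. \<exists>x. x + n \<le> d \<and> (\<forall>q<n. u[i := \<not> u ! i] ! (x + q) = f ! q)"
    using blocked len by (auto simp: sublist_iff_nth n_def D)
  then obtain w where "\<forall>i\<in>D. w i + n \<le> d \<and> (\<forall>q<n. u[i := \<not> u ! i] ! (w i + q) = f ! q)"
    by (rule bchoice[THEN exE])
  then have w: "w i + n \<le> d" "\<And>q. q < n \<Longrightarrow> u[i := \<not> u ! i] ! (w i + q) = f ! q"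
    if "i \<in> D" for i
    using that by blast+
  \<comment> \<open>Otherwise the flip leaves the window untouched and \<open>f\<close> occurs in
    \<open>u\<close> already.\<close>
  have cover: "w i \<le> i \<and> i < w i + n" if "i \<in> D" for i
  proof (rule ccontr)
    assume "\<not> (w i \<le> i \<and> i < w i + n)"
    then have "u ! (w i + q) = f ! q" if "q < n" for q
      using w(2)[OF \<open>i \<in> D\<close> that] that by (subst (asm) nth_list_update_neq) auto
    then show False
      using \<open>\<not> sublist f u\<close> w(1)[OF that] len by (auto simp: sublist_iff_nth n_def)
  qed
  \<comment> \<open>Otherwise \<open>u\<close> with bit \<open>i\<close> flipped agrees with
    \<open>v\<close> on the whole window, and \<open>f\<close> occurs in \<open>v\<close>.\<close>
  have other: "\<exists>j\<in>D. j \<noteq> i \<and> w i \<le> j \<and> j < w i + n" if "i \<in> D" for i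
  proof (rule ccontr)
    assume no: "\<not> (\<exists>j\<in>D. j \<noteq> i \<and> w i \<le> j \<and> j < w i + n)"
    have "v ! (w i + q) = f ! q" if "q < n" for q
    proof -
      have "v ! (w i + q) = u[i := \<not> u ! i] ! (w i + q)"
        using no D[of "w i + q"] D[of i] that w(1)[OF \<open>i \<in> D\<close>] len \<open>i \<in> D\<close>
        by (auto simp: nth_list_update)
      then show ?thesis
        using w(2)[OF \<open>i \<in> D\<close> that] by simp
    qed
    then show False
      using \<open>\<not> sublist f v\<close> w(1)[OF that] len by (auto simp: sublist_iff_nth n_def)
  qed
  \<comment> \<open>The last element of \<open>R\<close> will be the left member of the pair.
    \<open>R\<close> is nonempty, because the window of the first difference can only reach a later
    one.\<close>
  define R where "R = {i \<in> D. \<exists>j\<in>D. i < j \<and> j < w i + n}"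
  have "finite R" by (simp add: R_def)
  obtain a where "a \<in> D" "a \<noteq> Min D" "a < w (Min D) + n"
    using other Min_in[of D] \<open>D \<noteq> {}\<close> \<open>finite D\<close> by blast
  moreover from this have "Min D < a"
    using Min_le[of D a] \<open>finite D\<close> by linarith
  ultimately have "Min D \<in> R"
    using \<open>D \<noteq> {}\<close> unfolding R_def by auto
  define i where "i = Max R"
  have "i \<in> R"
    using Max_in[of R] \<open>finite R\<close> \<open>Min D \<in> R\<close> unfolding i_def by blast
  then have i: "i \<in> D" "i \<in> R"
    by (simp_all add: R_def)
  define j where "j = Min {j \<in> D. i < j}"
  obtain j' where j': "j' \<in> D" "i < j'" "j' < w i + n"
    using i by (auto simp: R_def)
  then have "j \<in> {j \<in> D. i < j}"
    unfolding j_def by (intro Min_in) auto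
  then have j: "j \<in> D" "i < j"
    by simp_all
  have j_le: "j \<le> a" if "a \<in> D" "i < a" for a
    using that unfolding j_def by simp
  have "j < w i + n"
    using j_le j' by fastforce
  have "j \<notin> R"
  proof
    assume "j \<in> R"
    then have "j \<le> i"
      unfolding i_def using \<open>finite R\<close> by (rule Max_ge[rotated])
    then show False
      using j by simp
  qed
  obtain a where a: "a \<in> D" "a \<noteq> j" "w j \<le> a" "a < w j + n"
    using other j by blast
  \<comment> \<open>By maximality of \<open>i\<close>, the window of the next difference \<open>j\<close> reaches no later difference, so it reaches back to \<open>i\<close>.\<close>
  have "a \<le> i"
    using a \<open>j \<notin> R\<close> j j_le by (fastforce simp: R_def)
  then have wj: "w j \<le> i" "i < w j + n"
    using a j cover[of j] by auto
  have wi: "w i \<le> j" "j < w i + n"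
    using cover[of i] i j \<open>j < w i + n\<close> by auto
  \<comment> \<open>With equal starts both modified words would carry the same letter at position
    \<open>i\<close>, but only one of them has this bit flipped.\<close>
  have "w i \<noteq> w j"
  proof
    assume eq: "w i = w j"
    have "u[i := \<not> u ! i] ! i = u[j := \<not> u ! j] ! i"
      using w(2)[of i "i - w i"] w(2)[of j "i - w i"] i j cover[of i] eq by force
    then show False
      using i j D len by auto
  qed
  have facts: "i < d" "j < d" "w i + n \<le> d" "w j + n \<le> d" "w i \<le> i" "i < w i + n" "w j \<le> j" "j < w j + n"
    using i j D cover w(1) by auto
  show ?thesis
  proof (cases "w i < w j")
    case True
    have "card (shift_errors f (w j - w i)) = 2"
      by (rule shift_errors_of_two_windows[of u d "w i" "w j" f i j])
         (use True facts wi wj i(1) j w(2)[OF i(1)] w(2)[OF j(1)] len in \<open>simp_all add: n_def\<close>)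
    then show ?thesis
      using True facts by (intro exI[of _ "w j - w i"]) (auto simp: n_def)
  next
    case False
    then have "w j < w i" using \<open>w i \<noteq> w j\<close> by simp
    have "card (shift_errors f (w i - w j)) = 2"
      by (rule shift_errors_of_two_windows[of u d "w j" "w i" f j i])
         (use \<open>w j < w i\<close> facts wi wj i(1) j w(2)[OF i(1)] w(2)[OF j(1)] len in \<open>simp_all add: n_def\<close>)
    then show ?thesis
      using \<open>w j < w i\<close> facts by (intro exI[of _ "w i - w j"]) (auto simp: n_def)
  qed
qed

section \<open>Gluing two overlapping copies of a word\<close>

text \<open>The left copy, at \<open>0\<close>, overrides the right copy, at \<open>m\<close>, up to
  a flip at \<open>i\<close>. For \<open>i = x + m\<close> with an error \<open>x\<close> the flip
  hands this position over to the right copy.\<close>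

definition glue :: "bool list \<Rightarrow> nat \<Rightarrow> nat \<Rightarrow> bool list" where
  "glue f m i =
    map (\<lambda>p. if p < length f then (if p = i then \<not> f ! p else f ! p) else f ! (p - m)) [0..<length f + m]"

lemma length_glue [simp]: "length (glue f m i) = length f + m"
  by (simp add: glue_def)

lemma nth_glue:
  "p < length f + m \<Longrightarrow>
    glue f m i ! p = (if p < length f then (if p = i then \<not> f ! p else f ! p) else f ! (p - m))"
  by (simp add: glue_def)

text \<open>The left copy would spoil the right one at its letters \<open>x\<close> and
  \<open>y\<close> only; the flip at \<open>x + m\<close> repairs the former and leaves the
  latter.\<close>

lemma nth_glue_right:
  assumes errors: "shift_errors f m = {x, y}" and "x \<noteq> y" "q < length f"
  shows "glue f m (x + m) ! (m + q) = (if q = y then \<not> f ! q else f ! q)"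
proof (cases "m + q < length f")
  case True
  have "(q \<in> shift_errors f m) = (f ! q \<noteq> f ! (q + m))"
    using True by (simp add: shift_errors_def add.commute[of q m])
  then have mismatch: "(f ! (m + q) = (\<not> f ! q)) = (q = x \<or> q = y)"
    unfolding errors by (simp only: insert_iff empty_iff add.commute[of q m]) blast
  have "glue f m (x + m) ! (m + q) = (if q = x then \<not> f ! (m + q) else f ! (m + q))"
    using True by (simp add: nth_glue)
  then show ?thesis
    using mismatch \<open>x \<noteq> y\<close> by argo
next
  case False
  have "y \<in> shift_errors f m"
    by (simp add: errors)
  then have "q \<noteq> y"
    using False by (auto simp: shift_errors_def)
  then show ?thesis
    using False \<open>q < length f\<close> by (simp add: nth_glue)
qed

text \<open>A copy of \<open>f\<close> at start \<open>z\<close> is compared with the left copy,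
  which is a shift by \<open>z\<close>, and with the right copy, a shift by \<open>m - z\<close>.
  Each comparison sees at most the one defect of that glued copy, but the smaller of the two shifts
  is at most \<open>m / 2\<close> and so has more than two errors.\<close>

lemma not_sublist_glue:
  assumes xy: "shift_errors f m = {x, y}" "x \<noteq> y"
    and many: "\<And>l. 1 \<le> l \<Longrightarrow> 2 * l \<le> m \<Longrightarrow> 2 < card (shift_errors f l)"
  shows "\<not> sublist f (glue f m (x + m))"
proof
  assume "sublist f (glue f m (x + m))"
  then obtain z where "z \<le> m" and z: "\<And>q. q < length f \<Longrightarrow> glue f m (x + m) ! (z + q) = f ! q"
    by (auto simp: sublist_iff_nth)
  have x: "x + m < length f" and y: "y + m < length f"
    using xy by (auto simp: shift_errors_def)
  \<comment> \<open>The starts \<open>0\<close> and \<open>m\<close> are excluded by the defects of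
    the two glued copies themselves.\<close>
  have "z \<noteq> 0"
  proof
    assume "z = 0"
    then have "glue f m (x + m) ! (x + m) = f ! (x + m)"
      using z[of "x + m"] x by simp
    then show False
      using x by (simp add: nth_glue)
  qed
  have "z \<noteq> m"
  proof
    assume "z = m"
    then have "glue f m (x + m) ! (m + y) = f ! y"
      using z[of y] y by simp
    then show False
      using nth_glue_right[OF xy, of y] y by simp
  qed
  \<comment> \<open>The left copy departs from the glued word at position \<open>x + m\<close>
    only.\<close>
  have "shift_errors f z \<subseteq> {x + m - z}"
  proof
    fix q assume q: "q \<in> shift_errors f z"
    then have lt: "z + q < length f" and "f ! (z + q) \<noteq> f ! q"
      by (auto simp: shift_errors_def add.commute)
    then have "z + q = x + m"
      using z[of q] by (auto simp: nth_glue split: if_splits)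
    then show "q \<in> {x + m - z}"
      by simp
  qed
  then have "card (shift_errors f z) \<le> 1"
    using card_mono[of "{x + m - z}" "shift_errors f z"] by simp
  \<comment> \<open>The right copy departs from the glued word at its letter \<open>y\<close>
    only.\<close>
  have "shift_errors f (m - z) \<subseteq> {y}"
  proof
    fix q assume "q \<in> shift_errors f (m - z)"
    then have q: "q + (m - z) < length f" "f ! (q + (m - z)) \<noteq> f ! q"
      by (auto simp: shift_errors_def)
    moreover have "z + (q + (m - z)) = m + q"
      using \<open>z \<le> m\<close> by simp
    ultimately have "glue f m (x + m) ! (m + q) \<noteq> f ! q"
      using z by metis
    then show "q \<in> {y}"
      using nth_glue_right[OF xy, of q] q by (auto split: if_splits)
  qed
  then have "card (shift_errors f (m - z)) \<le> 1"
    using card_mono[of "{y}" "shift_errors f (m - z)"] by simp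
  show False
  proof (cases "2 * z \<le> m")
    case True
    then show ?thesis
      using many[of z] \<open>z \<noteq> 0\<close> \<open>card (shift_errors f z) \<le> 1\<close> by simp
  next
    case False
    then have "1 \<le> m - z" "2 * (m - z) \<le> m"
      using \<open>z \<le> m\<close> \<open>z \<noteq> m\<close> by linarith+
    then show ?thesis
      using many[of "m - z"] \<open>card (shift_errors f (m - z)) \<le> 1\<close> by simp
  qed
qed

text \<open>The glued words for \<open>x\<close> and for \<open>y\<close> differ at the two error
  positions only. Flipping \<open>u\<close> towards \<open>v\<close>, one of these completes the
  left copy and the other the right copy.\<close>

lemma blocked_pair_of_two_errors:
  assumes two: "card (shift_errors f m) = 2"
    and many: "\<And>l. 1 \<le> l \<Longrightarrow> 2 * l \<le> m \<Longrightarrow> 2 < card (shift_errors f l)"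
  shows "\<exists>u v. blocked_pair (length f + m) f u v"
proof -
  obtain x y where xy: "shift_errors f m = {x, y}" "x \<noteq> y"
    using two by (auto simp: card_2_iff)
  then have yx: "shift_errors f m = {y, x}" "y \<noteq> x"
    by auto
  have lt: "x + m < length f" "y + m < length f"
    using xy by (auto simp: shift_errors_def)
  define u where "u = glue f m (x + m)"
  define v where "v = glue f m (y + m)"
  have len: "length u = length f + m" "length v = length f + m"
    by (simp_all add: u_def v_def)
  have diffs: "diffs u v = {x + m, y + m}"
    using lt xy(2) by (auto simp: diffs_def u_def v_def nth_glue split: if_splits)
  \<comment> \<open>Undoing the flip at \<open>x + m\<close> restores the left copy, at start
    \<open>0\<close>.\<close>
  have "\<exists>z. z + length f \<le> length u \<and> (\<forall>q<length f. u[x + m := v ! (x + m)] ! (z + q) = f ! q)"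
    using lt xy(2) by (intro exI[of _ 0]) (auto simp: u_def v_def nth_list_update nth_glue)
  \<comment> \<open>The only defect of the right copy, at start \<open>m\<close>, is its letter
    \<open>y\<close>, at position \<open>y + m\<close>.\<close>
  moreover have "\<exists>z. z + length f \<le> length u \<and> (\<forall>q<length f. u[y + m := v ! (y + m)] ! (z + q) = f ! q)"
    using lt xy(2) nth_glue_right[OF xy] nth_glue_right[OF yx, of y]
    by (intro exI[of _ m]) (auto simp: u_def v_def nth_list_update add.commute)
  ultimately have "sublist f (u[i := v ! i])" if "i \<in> diffs u v" for i
    using that unfolding diffs by (auto simp: sublist_iff_nth)
  moreover have "u \<noteq> v"
    using diffs by (auto simp: diffs_def)
  ultimately show ?thesis
    using not_sublist_glue[OF xy many] not_sublist_glue[OF yx many] len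
    unfolding blocked_pair_def u_def[symmetric] v_def[symmetric] by blast
qed

section \<open>The index in terms of two-error shifts\<close>

lemma cube_index_eq_Inf: "cube_index f = Inf (enat ` {d. d \<ge> 1 \<and> (\<exists>u v. blocked_pair d f u v)})"
  by (simp add: cube_index_def isometric_iff_no_blocked_pair)

lemma cube_index_infinity:
  assumes "\<And>m. m \<ge> 1 \<Longrightarrow> card (shift_errors f m) \<noteq> 2"
  shows "cube_index f = \<infinity>"
proof -
  have none: "{d. d \<ge> 1 \<and> (\<exists>u v. blocked_pair d f u v)} = {}"
    using blocked_pair_imp_two_errors assms by blast
  show ?thesis
    unfolding cube_index_eq_Inf none by (simp add: top_enat_def)
qed

text \<open>Gluing at shift \<open>M\<close> bounds the index from above. From below, every blocked
  pair yields a two-error shift, and none is smaller than \<open>M\<close>.\<close>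

lemma cube_index_eq_enat:
  assumes "M \<ge> 1" "card (shift_errors f M) = 2"
    and less: "\<And>m. 1 \<le> m \<Longrightarrow> m < M \<Longrightarrow>
      card (shift_errors f m) \<noteq> 2 \<and> (2 * m \<le> M \<longrightarrow> 2 < card (shift_errors f m))"
  shows "cube_index f = enat (length f + M)"
proof -
  \<comment> \<open>From \<open>1 \<le> l\<close> and \<open>2 * l \<le> M\<close> follows
    \<open>l < M\<close>, so \<open>less\<close> applies to all shifts that gluing asks
    about.\<close>
  have "\<exists>u v. blocked_pair (length f + M) f u v"
    using assms(1) less by (intro blocked_pair_of_two_errors assms(2)) auto
  moreover have "length f + M \<le> d" if blocked: "blocked_pair d f u v" for d u v
  proof -
    obtain m where "m \<ge> 1" "card (shift_errors f m) = 2" "length f + m \<le> d"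
      using blocked_pair_imp_two_errors[OF blocked] by blast
    then show ?thesis
      using less[of m] by linarith
  qed
  ultimately show ?thesis
    unfolding cube_index_eq_Inf using \<open>M \<ge> 1\<close>
    by (intro antisym Inf_lower Inf_greatest) auto
qed

section \<open>Invariance under complement and reversal\<close>

lemma sublist_map_Not: "sublist (map Not f) (map Not u) \<longleftrightarrow> sublist f u"
proof -
  have "map Not (map Not w) = w" for w
    by (simp add: o_def)
  then show ?thesis
    by (metis map_mono_sublist)
qed

text \<open>Reversal moves position \<open>i\<close> to \<open>d - Suc i\<close>, and complementing
  commutes with flips, so blocked flips go to blocked flips.\<close>

lemma blocked_pair_map_Not_rev:
  assumes "blocked_pair d f u v"
  shows "blocked_pair d (map Not (rev f)) (map Not (rev u)) (map Not (rev v))"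
proof -
  have len: "length u = d" "length v = d"
    using assms by (auto simp: blocked_pair_def)
  have "sublist (map Not (rev f)) ((map Not (rev u))[i := map Not (rev v) ! i])"
    if "i \<in> diffs (map Not (rev u)) (map Not (rev v))" for i
  proof -
    have "i < d" "d - Suc i \<in> diffs u v"
      using that len by (auto simp: diffs_def rev_nth)
    then have "sublist f (u[d - Suc i := v ! (d - Suc i)])"
      using assms by (auto simp: blocked_pair_def)
    moreover have "(map Not (rev u))[i := map Not (rev v) ! i] = map Not (rev (u[d - Suc i := v ! (d - Suc i)]))"
      using \<open>i < d\<close> len by (simp add: rev_update map_update rev_nth)
    ultimately show ?thesis
      by (simp only: sublist_map_Not sublist_rev)
  qed
  moreover have "map Not (rev u) \<noteq> map Not (rev v)"
    using assms inj_map_eq_map[of Not] by (simp add: blocked_pair_def inj_def)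
  ultimately show ?thesis
    using assms by (auto simp: blocked_pair_def sublist_map_Not)
qed

text \<open>The transformation is an involution, so transporting blocked pairs in one direction
  gives both.\<close>

lemma cube_index_map_Not_rev: "cube_index (map Not (rev f)) = cube_index f"
proof -
  have "map Not (rev (map Not (rev f))) = f"
    by (simp add: rev_map o_def)
  then have "blocked_pair d f (map Not (rev u)) (map Not (rev v))"
    if "blocked_pair d (map Not (rev f)) u v" for d u v
    using blocked_pair_map_Not_rev[OF that] by metis
  then have "(\<exists>u v. blocked_pair d (map Not (rev f)) u v) \<longleftrightarrow> (\<exists>u v. blocked_pair d f u v)" for d
    using blocked_pair_map_Not_rev by blast
  then show ?thesis
    by (simp add: cube_index_eq_Inf)
qed

lemma map_Not_rev_four_blocks: "map Not (rev (four_blocks r s t k)) = four_blocks k t s r"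
  by (simp add: four_blocks_def map_replicate_const)

section \<open>Errors of shifts of four-block words\<close>

text \<open>
  The overlap of a four-block word with its translate by \<open>m\<close> is a prefix, whose ones are counted by the
  first two summands, matched with a suffix, whose ones are counted by the third summand and by
  \<open>max 0 (r - m)\<close>. The positions where both have a one, which enter with the factor \<open>-2\<close>, are counted by
  \<open>max 0 (r - m)\<close> again and by the last two brackets.
\<close>

definition shift_count :: "int \<Rightarrow> int \<Rightarrow> int \<Rightarrow> int \<Rightarrow> int \<Rightarrow> int" where
  "shift_count r s t k m =
     (if m \<le> s + t + k then r else r + s + t + k - m)
   + (if m \<le> k then t else if m \<le> t + k then t + k - m else 0)
   + (if m \<le> r + s then t else if m \<le> r + s + t then r + s + t - m else 0)
   - (if m \<le> r then r - m else 0)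
   - 2 * (if m \<le> t then t - m else 0)
   - 2 * (if m \<le> s then 0
          else if m \<le> s + t then (if m \<le> r + s then m - s else r)
          else if m \<le> r + s then t
          else if m \<le> r + s + t then r + s + t - m else 0)"

lemma nth_four_blocks:
  "x < r + s + t + k \<Longrightarrow> four_blocks r s t k ! x \<longleftrightarrow> x < r \<or> (r + s \<le> x \<and> x < r + s + t)"
  by (auto simp: four_blocks_def nth_append)

lemma length_four_blocks [simp]: "length (four_blocks r s t k) = r + s + t + k"
  by (simp add: four_blocks_def)

text \<open>\<open>A\<close> holds the positions of ones in the prefix and \<open>B\<close> the
  positions whose translates are ones. The errors are their symmetric difference, whose size is
  \<open>card A + card B\<close> minus twice \<open>card (A \<inter> B)\<close>.\<close>

lemma card_shift_errors_four_blocks: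
  assumes "m \<le> r + s + t + k"
  shows "int (card (shift_errors (four_blocks r s t k) m)) = shift_count r s t k m"
proof -
  define n where "n = r + s + t + k"
  define A where "A = {0..<min r (n - m)} \<union> {r + s..<min (r + s + t) (n - m)}"
  define B where "B = {0..<r - m} \<union> {r + s - m..<r + s + t - m}"
  have sym_diff: "shift_errors (four_blocks r s t k) m = (A - B) \<union> (B - A)"
    unfolding shift_errors_def A_def B_def n_def
    by (rule set_eqI) (auto simp: nth_four_blocks)
  have "finite A" "finite B"
    by (simp_all add: A_def B_def)
  then have "card (shift_errors (four_blocks r s t k) m) = card (A - B) + card (B - A)"
    unfolding sym_diff by (intro card_Un_disjoint) auto
  moreover have "card A = card (A \<inter> B) + card (A - B)" "card B = card (A \<inter> B) + card (B - A)"
    using \<open>finite A\<close> \<open>finite B\<close> card_Int_Diff[of A B] card_Int_Diff[of B A]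
    by (simp_all add: Int_commute)
  ultimately have errors: "int (card (shift_errors (four_blocks r s t k) m)) =
      int (card A) + int (card B) - 2 * int (card (A \<inter> B))"
    by linarith
  have disjoint: "{a..<b} \<inter> {c..<d} = {}" if "b \<le> c" for a b c d :: nat
    using that by auto
  have "card A = min r (n - m) + (min (r + s + t) (n - m) - (r + s))"
    unfolding A_def by (simp add: card_Un_disjoint disjoint)
  moreover have "int (min r (n - m)) =
      (if int m \<le> int s + int t + int k then int r else int r + int s + int t + int k - int m)"
    using assms by (simp add: n_def min_def) linarith
  moreover have "int (min (r + s + t) (n - m) - (r + s)) =
      (if int m \<le> int k then int t else if int m \<le> int t + int k then int t + int k - int m else 0)"
    using assms by (simp add: n_def min_def) linarith
  ultimately have A: "int (card A) =
      (if int m \<le> int s + int t + int k then int r else int r + int s + int t + int k - int m)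
      + (if int m \<le> int k then int t else if int m \<le> int t + int k then int t + int k - int m else 0)"
    by (simp only: of_nat_add)
  have "card B = (r - m) + (r + s + t - m - (r + s - m))"
    unfolding B_def
    by (simp only: card_Un_disjoint disjoint finite_atLeastLessThan card_atLeastLessThan
        diff_zero diff_le_mono le_add1)
  moreover have first: "int (r - m) = (if int m \<le> int r then int r - int m else 0)"
    by simp
  moreover have "int (r + s + t - m - (r + s - m)) =
      (if int m \<le> int r + int s then int t
       else if int m \<le> int r + int s + int t then int r + int s + int t - int m else 0)"
    by simp
  ultimately have B: "int (card B) = (if int m \<le> int r then int r - int m else 0)
      + (if int m \<le> int r + int s then int t
         else if int m \<le> int r + int s + int t then int r + int s + int t - int m else 0)"
    by (simp only: of_nat_add)
  \<comment> \<open>Blocks of ones meet in three ways: first with first, first with second, second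
    with second. The fourth is impossible, as translating moves to the right.\<close>
  have "A \<inter> B = {0..<r - m} \<union> ({r + s - m..<min r (r + s + t - m)} \<union> {r + s..<r + s + t - m})"
    by (auto simp: A_def B_def n_def)
  moreover have "card \<dots> = (r - m) + ((min r (r + s + t - m) - (r + s - m)) + (r + s + t - m - (r + s)))"
    by (subst card_Un_disjoint, simp, simp, fastforce, subst card_Un_disjoint) auto
  moreover have "int (r + s + t - m - (r + s)) = (if int m \<le> int t then int t - int m else 0)"
    by simp
  moreover have "int (min r (r + s + t - m) - (r + s - m)) =
      (if int m \<le> int s then 0
       else if int m \<le> int s + int t then (if int m \<le> int r + int s then int m - int s else int r)
       else if int m \<le> int r + int s then int t
       else if int m \<le> int r + int s + int t then int r + int s + int t - int m else 0)"
    by (simp add: min_def) linarith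
  ultimately have AB: "int (card (A \<inter> B)) = (if int m \<le> int r then int r - int m else 0) +
      ((if int m \<le> int s then 0
        else if int m \<le> int s + int t then (if int m \<le> int r + int s then int m - int s else int r)
        else if int m \<le> int r + int s then int t
        else if int m \<le> int r + int s + int t then int r + int s + int t - int m else 0)
       + (if int m \<le> int t then int t - int m else 0))"
    using first by (simp only: of_nat_add)
  show ?thesis
    unfolding errors A B AB shift_count_def by simp
qed

text \<open>Over the integers the conditions on \<open>M\<close> are linear arithmetic without
  truncated subtraction; the separate \<open>b\<close> absorbs the various shapes of the index
  values.\<close>

lemma cube_index_four_blocks:
  fixes r s t k b :: nat and M :: int
  assumes b: "int b = r + s + t + k + M" and M: "1 \<le> M" "M \<le> r + s + t + k"
    and two: "shift_count r s t k M = 2"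
    and not_two: "\<And>m :: int. 1 \<le> m \<Longrightarrow> m < M \<Longrightarrow> shift_count r s t k m \<noteq> 2"
    and many: "\<And>m :: int. 1 \<le> m \<Longrightarrow> 2 * m \<le> M \<Longrightarrow> 2 < shift_count r s t k m"
  shows "cube_index (four_blocks r s t k) = enat b"
proof -
  obtain l where l: "M = int l"
    using M(1) by (metis zero_le_imp_eq_int order_trans zero_le_one)
  have errors: "int (card (shift_errors (four_blocks r s t k) m)) = shift_count r s t k m"
    if "m \<le> l" for m
    using M(2) l that by (intro card_shift_errors_four_blocks) linarith
  have "cube_index (four_blocks r s t k) = enat (length (four_blocks r s t k) + l)"
  proof (rule cube_index_eq_enat)
    show "card (shift_errors (four_blocks r s t k) l) = 2"
      using errors[of l] two l by simp
    show "card (shift_errors (four_blocks r s t k) m) \<noteq> 2 \<and>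
        (2 * m \<le> l \<longrightarrow> 2 < card (shift_errors (four_blocks r s t k) m))" if "1 \<le> m" "m < l" for m
    proof -
      have "shift_count r s t k m \<noteq> 2" "2 * m \<le> l \<Longrightarrow> 2 < shift_count r s t k m"
        using not_two[of "int m"] many[of "int m"] that l by simp_all
      then show ?thesis
        using errors[of m] that by linarith
    qed
  qed (use M l in simp)
  then show ?thesis
    using b l by simp
qed

text \<open>A shift by at least the length of the word has an empty overlap, so only smaller shifts
  need to be examined.\<close>

lemma cube_index_four_blocks_infinity:
  fixes r s t k :: nat
  assumes "\<And>m :: int. 1 \<le> m \<Longrightarrow> m < r + s + t + k \<Longrightarrow> shift_count r s t k m \<noteq> 2"
  shows "cube_index (four_blocks r s t k) = \<infinity>"
proof (rule cube_index_infinity)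
  fix m :: nat
  assume "1 \<le> m"
  show "card (shift_errors (four_blocks r s t k) m) \<noteq> 2"
  proof (cases "m < r + s + t + k")
    case True
    then show ?thesis
      using card_shift_errors_four_blocks[of m r s t k] assms[of "int m"] \<open>1 \<le> m\<close> by simp
  next
    case False
    then show ?thesis
      by (simp add: shift_errors_def)
  qed
qed

section \<open>Least two-error shifts of the families with finite index\<close>

text \<open>The three claims are what \<open>cube_index_four_blocks\<close> asks of its
  \<open>M\<close>; each is settled by a split into the linear pieces of \<open>shift_count\<close>.
  At \<open>M = r + s\<close> the prefix \<open>1^(t+2)\<close> faces the suffix
  \<open>1^t 0^2\<close>.\<close>

lemma shift_count_cond5:
  fixes r s t k m :: int
  assumes "t + 3 \<le> r" "1 \<le> t" "3 \<le> s" "k = 2"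
  shows "shift_count r s t k (r + s) = 2"
    and "1 \<le> m \<Longrightarrow> m < r + s \<Longrightarrow> shift_count r s t k m \<noteq> 2"
    and "1 \<le> m \<Longrightarrow> 2 * m \<le> r + s \<Longrightarrow> 2 < shift_count r s t k m"
  subgoal using assms unfolding shift_count_def by simp
  subgoal using assms unfolding shift_count_def by (smt (verit))
  subgoal using assms unfolding shift_count_def by (smt (verit))
  done

text \<open>At shift \<open>s + t\<close> the prefix \<open>1^(t+2) 0^k\<close> faces the suffix
  \<open>0^2 1^t 0^k\<close>.\<close>

lemma shift_count_cond6:
  fixes r s t k m :: int
  assumes "r = t + 2" "1 \<le> t" "2 \<le> s" "k \<le> s" "1 \<le> k"
  shows "shift_count r s t k (s + t) = 2"
    and "1 \<le> m \<Longrightarrow> m < s + t \<Longrightarrow> shift_count r s t k m \<noteq> 2"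
    and "1 \<le> m \<Longrightarrow> 2 * m \<le> s + t \<Longrightarrow> 2 < shift_count r s t k m"
  subgoal using assms unfolding shift_count_def by simp
  subgoal using assms unfolding shift_count_def by (smt (verit))
  subgoal using assms unfolding shift_count_def by (smt (verit))
  done

text \<open>Here and in the next two lemmas the prefix \<open>1^(t+2) 0^(k-1)\<close> faces the
  suffix \<open>0 1^t 0^k\<close>; the errors are on either side of \<open>1^t\<close>.\<close>

lemma shift_count_cond7_a:
  fixes r s t k m :: int
  assumes "t + 3 \<le> r" "1 \<le> t" "3 \<le> s" "k = 1"
  shows "shift_count r s t k (r + s - 1) = 2"
    and "1 \<le> m \<Longrightarrow> m < r + s - 1 \<Longrightarrow> shift_count r s t k m \<noteq> 2"
    and "1 \<le> m \<Longrightarrow> 2 * m \<le> r + s - 1 \<Longrightarrow> 2 < shift_count r s t k m"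
  subgoal using assms unfolding shift_count_def by simp
  subgoal using assms unfolding shift_count_def by (smt (verit))
  subgoal using assms unfolding shift_count_def by (smt (verit))
  done

lemma shift_count_cond7_b:
  fixes r s t k m :: int
  assumes "r = t + 2" "1 \<le> t" "s = 1" "k = 1"
  shows "shift_count r s t k (r + s - 1) = 2"
    and "1 \<le> m \<Longrightarrow> m < r + s - 1 \<Longrightarrow> shift_count r s t k m \<noteq> 2"
    and "1 \<le> m \<Longrightarrow> 2 * m \<le> r + s - 1 \<Longrightarrow> 2 < shift_count r s t k m"
  subgoal using assms unfolding shift_count_def by simp
  subgoal using assms unfolding shift_count_def by (auto split: if_splits; presburger)
  subgoal using assms unfolding shift_count_def by (smt (verit))
  done

lemma shift_count_cond7_c:
  fixes r s t k m :: int
  assumes "r = t + 2" "1 \<le> t" "2 \<le> s" "k = s + 1"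
  shows "shift_count r s t k (r + s - 1) = 2"
    and "1 \<le> m \<Longrightarrow> m < r + s - 1 \<Longrightarrow> shift_count r s t k m \<noteq> 2"
    and "1 \<le> m \<Longrightarrow> 2 * m \<le> r + s - 1 \<Longrightarrow> 2 < shift_count r s t k m"
  subgoal using assms unfolding shift_count_def by simp
  subgoal using assms unfolding shift_count_def by (smt (verit))
  subgoal using assms unfolding shift_count_def by (smt (verit))
  done

text \<open>The prefix \<open>1^(t+1) 0^s 1\<close> faces the suffix \<open>0 1^t 0^(s+1)\<close>,
  with errors at the first and the last letter.\<close>

lemma shift_count_cond8_a:
  fixes r s t k m :: int
  assumes "r = t + 1" "2 \<le> t" "1 \<le> s" "k = s + 1"
  shows "shift_count r s t k (s + t) = 2"
    and "1 \<le> m \<Longrightarrow> m < s + t \<Longrightarrow> shift_count r s t k m \<noteq> 2"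
    and "1 \<le> m \<Longrightarrow> 2 * m \<le> s + t \<Longrightarrow> 2 < shift_count r s t k m"
  subgoal using assms unfolding shift_count_def by simp
  subgoal using assms unfolding shift_count_def by (smt (verit))
  subgoal using assms unfolding shift_count_def by (smt (verit))
  done

text \<open>The prefix \<open>1^2 0^s 1 0^(k-s-1)\<close> faces the suffix
  \<open>0 1 0^k\<close>.\<close>

lemma shift_count_cond8_b:
  fixes r s t k m :: int
  assumes "r = 2" "t = 1" "1 \<le> s" "s + 1 \<le> k"
  shows "shift_count r s t k (s + t) = 2"
    and "1 \<le> m \<Longrightarrow> m < s + t \<Longrightarrow> shift_count r s t k m \<noteq> 2"
    and "1 \<le> m \<Longrightarrow> 2 * m \<le> s + t \<Longrightarrow> 2 < shift_count r s t k m"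
  subgoal using assms unfolding shift_count_def by simp
  subgoal using assms unfolding shift_count_def by (auto split: if_splits; presburger)
  subgoal using assms unfolding shift_count_def by (smt (verit))
  done

text \<open>The shift by 1 errs at all three block boundaries; the shift by 2 makes the last letter
  of \<open>1^r\<close> and the single \<open>1\<close> coincide and keeps two errors.\<close>

lemma shift_count_cond8_c:
  fixes r s t k m :: int
  assumes "3 \<le> r" "t = 1" "s = 1" "3 \<le> k"
  shows "shift_count r s t k (s + t) = 2"
    and "1 \<le> m \<Longrightarrow> m < s + t \<Longrightarrow> shift_count r s t k m \<noteq> 2"
    and "1 \<le> m \<Longrightarrow> 2 * m \<le> s + t \<Longrightarrow> 2 < shift_count r s t k m"
  subgoal using assms unfolding shift_count_def by simp
  subgoal using assms unfolding shift_count_def by (smt (verit))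
  subgoal using assms unfolding shift_count_def by (smt (verit))
  done

text \<open>The shift by \<open>s + 1\<close> aligns the two ones and has a single error. One step
  further the suffix \<open>0^k\<close> faces a prefix with both ones.\<close>

lemma shift_count_cond9:
  fixes r s t k m :: int
  assumes "r = 1" "t = 1" "1 \<le> s" "s + 3 \<le> k"
  shows "shift_count r s t k (s + 2) = 2"
    and "1 \<le> m \<Longrightarrow> m < s + 2 \<Longrightarrow> shift_count r s t k m \<noteq> 2"
    and "1 \<le> m \<Longrightarrow> 2 * m \<le> s + 2 \<Longrightarrow> 2 < shift_count r s t k m"
  subgoal using assms unfolding shift_count_def by simp
  subgoal using assms unfolding shift_count_def by (smt (verit))
  subgoal using assms unfolding shift_count_def by (smt (verit))
  done

text \<open>The prefix \<open>1 0^s\<close> faces the suffix \<open>0^(s-k) 1 0^k\<close>.\<close>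

lemma shift_count_cond10:
  fixes r s t k m :: int
  assumes "r = 1" "t = 1" "k + 1 \<le> s" "1 \<le> k"
  shows "shift_count r s t k (k + 1) = 2"
    and "1 \<le> m \<Longrightarrow> m < k + 1 \<Longrightarrow> shift_count r s t k m \<noteq> 2"
    and "1 \<le> m \<Longrightarrow> 2 * m \<le> k + 1 \<Longrightarrow> 2 < shift_count r s t k m"
  subgoal using assms unfolding shift_count_def by simp
  subgoal using assms unfolding shift_count_def by (auto split: if_splits; presburger)
  subgoal using assms unfolding shift_count_def by (smt (verit))
  done

text \<open>The prefix \<open>1^r 0^(k+1)\<close> faces the suffix \<open>0 1^r 0^k\<close>.\<close>

lemma shift_count_cond11:
  fixes r s t k m :: int
  assumes "2 \<le> r" "t = r" "k + 1 \<le> s" "1 \<le> k"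
  shows "shift_count r s t k (r + s - 1) = 2"
    and "1 \<le> m \<Longrightarrow> m < r + s - 1 \<Longrightarrow> shift_count r s t k m \<noteq> 2"
    and "1 \<le> m \<Longrightarrow> 2 * m \<le> r + s - 1 \<Longrightarrow> 2 < shift_count r s t k m"
  subgoal using assms unfolding shift_count_def by simp
  subgoal using assms unfolding shift_count_def by (smt (verit))
  subgoal using assms unfolding shift_count_def by (smt (verit))
  done

text \<open>The prefix \<open>1^r 0^(k+2)\<close> faces the suffix
  \<open>1^(r+2) 0^k\<close>.\<close>

lemma shift_count_cond12:
  fixes r s t k m :: int
  assumes "1 \<le> r" "r + 2 \<le> t" "k + 2 \<le> s" "1 \<le> k"
  shows "shift_count r s t k (s + t - 2) = 2"
    and "1 \<le> m \<Longrightarrow> m < s + t - 2 \<Longrightarrow> shift_count r s t k m \<noteq> 2"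
    and "1 \<le> m \<Longrightarrow> 2 * m \<le> s + t - 2 \<Longrightarrow> 2 < shift_count r s t k m"
  subgoal using assms unfolding shift_count_def by simp
  subgoal using assms unfolding shift_count_def by (smt (verit))
  subgoal using assms unfolding shift_count_def by (smt (verit))
  done

text \<open>A prefix that begins with \<open>1^r 0^s 1^2\<close> faces the suffix
  \<open>1^r 0^k\<close>, so the errors are the block \<open>1^2\<close>.\<close>

lemma shift_count_cond13:
  fixes r s t k m :: int
  assumes "1 \<le> r" "r \<le> 2" "t = 2" "1 \<le> s" "s + 3 \<le> k"
  shows "shift_count r s t k (s + 2) = 2"
    and "1 \<le> m \<Longrightarrow> m < s + 2 \<Longrightarrow> shift_count r s t k m \<noteq> 2"
    and "1 \<le> m \<Longrightarrow> 2 * m \<le> s + 2 \<Longrightarrow> 2 < shift_count r s t k m"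
  subgoal using assms unfolding shift_count_def by simp
  subgoal using assms unfolding shift_count_def by (smt (verit))
  subgoal using assms unfolding shift_count_def by (smt (verit))
  done

text \<open>Here and in the next three lemmas the overlap has only two letters, \<open>1^2\<close>
  facing \<open>0^2\<close>.\<close>

lemma shift_count_cond14_a:
  fixes r s t k m :: int
  assumes "s + 3 \<le> k" "3 \<le> r" "t = 2" "1 \<le> s"
  shows "shift_count r s t k (r + s + t + k - 2) = 2"
    and "1 \<le> m \<Longrightarrow> m < r + s + t + k - 2 \<Longrightarrow> shift_count r s t k m \<noteq> 2"
    and "1 \<le> m \<Longrightarrow> 2 * m \<le> r + s + t + k - 2 \<Longrightarrow> 2 < shift_count r s t k m"
  subgoal using assms unfolding shift_count_def by simp
  subgoal using assms unfolding shift_count_def by (auto split: if_splits; presburger)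
  subgoal using assms unfolding shift_count_def by (smt (verit))
  done

lemma shift_count_cond14_b:
  fixes r s t k m :: int
  assumes "s + 3 \<le> k" "r = 3" "t = 1" "2 \<le> s"
  shows "shift_count r s t k (r + s + t + k - 2) = 2"
    and "1 \<le> m \<Longrightarrow> m < r + s + t + k - 2 \<Longrightarrow> shift_count r s t k m \<noteq> 2"
    and "1 \<le> m \<Longrightarrow> 2 * m \<le> r + s + t + k - 2 \<Longrightarrow> 2 < shift_count r s t k m"
  subgoal using assms unfolding shift_count_def by simp
  subgoal using assms unfolding shift_count_def by (auto split: if_splits; presburger)
  subgoal using assms unfolding shift_count_def by (smt (verit))
  done

lemma shift_count_cond14_c:
  fixes r s t k m :: int
  assumes "s + 3 \<le> k" "t \<le> r" "3 \<le> t" "1 \<le> s"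
  shows "shift_count r s t k (r + s + t + k - 2) = 2"
    and "1 \<le> m \<Longrightarrow> m < r + s + t + k - 2 \<Longrightarrow> shift_count r s t k m \<noteq> 2"
    and "1 \<le> m \<Longrightarrow> 2 * m \<le> r + s + t + k - 2 \<Longrightarrow> 2 < shift_count r s t k m"
  subgoal using assms unfolding shift_count_def by simp
  subgoal using assms unfolding shift_count_def by (smt (verit))
  subgoal using assms unfolding shift_count_def by (smt (verit))
  done

lemma shift_count_cond14_d:
  fixes r s t k m :: int
  assumes "s + 3 \<le> k" "3 \<le> r" "r + 1 \<le> t" "1 \<le> s"
  shows "shift_count r s t k (r + s + t + k - 2) = 2"
    and "1 \<le> m \<Longrightarrow> m < r + s + t + k - 2 \<Longrightarrow> shift_count r s t k m \<noteq> 2"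
    and "1 \<le> m \<Longrightarrow> 2 * m \<le> r + s + t + k - 2 \<Longrightarrow> 2 < shift_count r s t k m"
  subgoal using assms unfolding shift_count_def by simp
  subgoal using assms unfolding shift_count_def by (smt (verit))
  subgoal using assms unfolding shift_count_def by (smt (verit))
  done

text \<open>Here and in the next three lemmas the prefix \<open>1^r 0^(k-2)\<close> faces the suffix
  \<open>1^(r-2) 0^k\<close>.\<close>

lemma shift_count_cond15_a:
  fixes r s t k m :: int
  assumes "2 \<le> r" "t = r + 1" "k + 1 \<le> s" "2 \<le> k"
  shows "shift_count r s t k (s + t + 2) = 2"
    and "1 \<le> m \<Longrightarrow> m < s + t + 2 \<Longrightarrow> shift_count r s t k m \<noteq> 2"
    and "1 \<le> m \<Longrightarrow> 2 * m \<le> s + t + 2 \<Longrightarrow> 2 < shift_count r s t k m"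
  subgoal using assms unfolding shift_count_def by simp
  subgoal using assms unfolding shift_count_def by (auto split: if_splits; presburger)
  subgoal using assms unfolding shift_count_def by (smt (verit))
  done

lemma shift_count_cond15_b:
  fixes r s t k m :: int
  assumes "r = t + 1" "1 \<le> t" "k \<le> s" "2 \<le> k"
  shows "shift_count r s t k (s + t + 2) = 2"
    and "1 \<le> m \<Longrightarrow> m < s + t + 2 \<Longrightarrow> shift_count r s t k m \<noteq> 2"
    and "1 \<le> m \<Longrightarrow> 2 * m \<le> s + t + 2 \<Longrightarrow> 2 < shift_count r s t k m"
  subgoal using assms unfolding shift_count_def by simp
  subgoal using assms unfolding shift_count_def by (auto split: if_splits; presburger)
  subgoal using assms unfolding shift_count_def by (smt (verit))
  done

lemma shift_count_cond15_c:
  fixes r s t k m :: int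
  assumes "r = t + 2" "1 \<le> t" "2 \<le> s" "k = s + 2"
  shows "shift_count r s t k (s + t + 2) = 2"
    and "1 \<le> m \<Longrightarrow> m < s + t + 2 \<Longrightarrow> shift_count r s t k m \<noteq> 2"
    and "1 \<le> m \<Longrightarrow> 2 * m \<le> s + t + 2 \<Longrightarrow> 2 < shift_count r s t k m"
  subgoal using assms unfolding shift_count_def by simp
  subgoal using assms unfolding shift_count_def by (smt (verit))
  subgoal using assms unfolding shift_count_def by (smt (verit))
  done

lemma shift_count_cond15_d:
  fixes r s t k m :: int
  assumes "r = t" "2 \<le> t" "2 \<le> s" "k = s"
  shows "shift_count r s t k (s + t + 2) = 2"
    and "1 \<le> m \<Longrightarrow> m < s + t + 2 \<Longrightarrow> shift_count r s t k m \<noteq> 2"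
    and "1 \<le> m \<Longrightarrow> 2 * m \<le> s + t + 2 \<Longrightarrow> 2 < shift_count r s t k m"
  subgoal using assms unfolding shift_count_def by simp
  subgoal using assms unfolding shift_count_def by (auto split: if_splits; presburger)
  subgoal using assms unfolding shift_count_def by (smt (verit))
  done

section \<open>Families without two-error shifts\<close>

text \<open>A parity phenomenon: at each of these shifts the prefix has exactly one more
  \<open>1\<close> than the suffix, which makes the number of errors odd.\<close>

lemma shift_count_cond1:
  fixes r s t k m :: int
  assumes "r = 1" "1 \<le> t" "1 \<le> s" "k = s + 1" "1 \<le> m" "m < r + s + t + k"
  shows "shift_count r s t k m \<noteq> 2"
  using assms unfolding shift_count_def by (auto split: if_splits; presburger)

text \<open>The number of errors is odd by parity except at \<open>m = s + 1\<close>, where both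
  sides of the overlap are \<open>1 0^s\<close>.\<close>

lemma shift_count_cond2:
  fixes r s t k m :: int
  assumes "r = 1" "t = 1" "s = k" "1 \<le> k" "1 \<le> m" "m < r + s + t + k"
  shows "shift_count r s t k m \<noteq> 2"
  using assms unfolding shift_count_def by (auto split: if_splits; presburger)

text \<open>Parity leaves two exceptions: \<open>m = k + 1\<close>, with at least four errors, and
  \<open>m = k + t + 1\<close>, with none.\<close>

lemma shift_count_cond3:
  fixes r s t k m :: int
  assumes "r = 1" "2 \<le> t" "s = k + 1" "1 \<le> k" "1 \<le> m" "m < r + s + t + k"
  shows "shift_count r s t k m \<noteq> 2"
  using assms unfolding shift_count_def by (auto split: if_splits; presburger)

text \<open>Parity leaves two exceptions: \<open>m = k + 1\<close>, with four errors, and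
  \<open>m = s + 2\<close>, with none.\<close>

lemma shift_count_cond4:
  fixes r s t k m :: int
  assumes "r = 1" "t = 2" "k + 2 \<le> s" "2 \<le> k" "1 \<le> m" "m < r + s + t + k"
  shows "shift_count r s t k m \<noteq> 2"
  using assms unfolding shift_count_def by (auto split: if_splits; presburger)

section \<open>The index in the fifteen cases\<close>

lemma cube_index_cond1:
  assumes "cond1 r s t k"
  shows "cube_index (four_blocks r s t k) = \<infinity>"
proof (rule cube_index_four_blocks_infinity)
  fix m :: int
  assume "1 \<le> m" "m < r + s + t + k"
  then show "shift_count r s t k m \<noteq> 2"
    using assms by (intro shift_count_cond1) (simp_all add: cond1_def)
qed

lemma cube_index_cond2:
  assumes "cond2 r s t k"
  shows "cube_index (four_blocks r s t k) = \<infinity>"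
proof (rule cube_index_four_blocks_infinity)
  fix m :: int
  assume "1 \<le> m" "m < r + s + t + k"
  then show "shift_count r s t k m \<noteq> 2"
    using assms by (intro shift_count_cond2) (simp_all add: cond2_def)
qed

lemma cube_index_cond3:
  assumes "cond3 r s t k"
  shows "cube_index (four_blocks r s t k) = \<infinity>"
proof (rule cube_index_four_blocks_infinity)
  fix m :: int
  assume "1 \<le> m" "m < r + s + t + k"
  then show "shift_count r s t k m \<noteq> 2"
    using assms by (intro shift_count_cond3) (simp_all add: cond3_def)
qed

lemma cube_index_cond4:
  assumes "cond4 r s t k"
  shows "cube_index (four_blocks r s t k) = \<infinity>"
proof (rule cube_index_four_blocks_infinity)
  fix m :: int
  assume "1 \<le> m" "m < r + s + t + k"
  then show "shift_count r s t k m \<noteq> 2"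
    using assms by (intro shift_count_cond4) (simp_all add: cond4_def)
qed

lemma cube_index_cond5:
  assumes "cond5 r s t k"
  shows "cube_index (four_blocks r s t k) = enat (2*r + 2*s + t + 2)"
proof -
  have "int t + 3 \<le> int r" "1 \<le> int t" "3 \<le> int s" "int k = 2"
    using assms by (simp_all add: cond5_def)
  \<comment> \<open>The rotation puts the three claims on \<open>shift_count\<close> first, so that
    unification with them determines \<open>M\<close>.\<close>
  from shift_count_cond5[OF this] show ?thesis
    by (rule cube_index_four_blocks[rotated 3]) (use assms in \<open>auto simp: cond5_def\<close>)
qed

lemma cube_index_cond6:
  assumes "cond6 r s t k"
  shows "cube_index (four_blocks r s t k) = enat (3*t + 2*s + k + 2)"
proof -
  have "int r = int t + 2" "1 \<le> int t" "2 \<le> int s" "int k \<le> int s" "1 \<le> int k"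
    using assms by (simp_all add: cond6_def)
  from shift_count_cond6[OF this] show ?thesis
    by (rule cube_index_four_blocks[rotated 3]) (use assms in \<open>auto simp: cond6_def\<close>)
qed

lemma cube_index_cond7:
  assumes "cond7 r s t k"
  shows "cube_index (four_blocks r s t k) = enat (2*r + 2*s + t + k - 1)"
proof -
  from assms consider (a) "t + 3 \<le> r" "1 \<le> t" "3 \<le> s" "k = 1"
    | (b) "r = t + 2" "1 \<le> t" "s = 1" "k = 1"
    | (c) "r = t + 2" "1 \<le> t" "2 \<le> s" "k = s + 1"
    unfolding cond7_def by blast
  then show ?thesis
  proof cases
    case a
    then have "int t + 3 \<le> int r" "1 \<le> int t" "3 \<le> int s" "int k = 1"
      by simp_all
    from shift_count_cond7_a[OF this] show ?thesis
      by (rule cube_index_four_blocks[rotated 3]) (use a in auto)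
  next
    case b
    then have "int r = int t + 2" "1 \<le> int t" "int s = 1" "int k = 1"
      by simp_all
    from shift_count_cond7_b[OF this] show ?thesis
      by (rule cube_index_four_blocks[rotated 3]) (use b in auto)
  next
    case c
    then have "int r = int t + 2" "1 \<le> int t" "2 \<le> int s" "int k = int s + 1"
      by simp_all
    from shift_count_cond7_c[OF this] show ?thesis
      by (rule cube_index_four_blocks[rotated 3]) (use c in auto)
  qed
qed

lemma cube_index_cond8:
  assumes "cond8 r s t k"
  shows "cube_index (four_blocks r s t k) = enat (r + 2*s + 2*t + k)"
proof -
  from assms consider (a) "r = t + 1" "2 \<le> t" "1 \<le> s" "k = s + 1"
    | (b) "r = 2" "t = 1" "1 \<le> s" "s + 1 \<le> k"
    | (c) "3 \<le> r" "t = 1" "s = 1" "3 \<le> k"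
    unfolding cond8_def by blast
  then show ?thesis
  proof cases
    case a
    then have "int r = int t + 1" "2 \<le> int t" "1 \<le> int s" "int k = int s + 1"
      by simp_all
    from shift_count_cond8_a[OF this] show ?thesis
      by (rule cube_index_four_blocks[rotated 3]) (use a in auto)
  next
    case b
    then have "int r = 2" "int t = 1" "1 \<le> int s" "int s + 1 \<le> int k"
      by simp_all
    from shift_count_cond8_b[OF this] show ?thesis
      by (rule cube_index_four_blocks[rotated 3]) (use b in auto)
  next
    case c
    then have "3 \<le> int r" "int t = 1" "int s = 1" "3 \<le> int k"
      by simp_all
    from shift_count_cond8_c[OF this] show ?thesis
      by (rule cube_index_four_blocks[rotated 3]) (use c in auto)
  qed
qed

lemma cube_index_cond9:
  assumes "cond9 r s t k"
  shows "cube_index (four_blocks r s t k) = enat (2*s + k + 4)"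
proof -
  have "int r = 1" "int t = 1" "1 \<le> int s" "int s + 3 \<le> int k"
    using assms by (simp_all add: cond9_def)
  from shift_count_cond9[OF this] show ?thesis
    by (rule cube_index_four_blocks[rotated 3]) (use assms in \<open>auto simp: cond9_def\<close>)
qed

lemma cube_index_cond10:
  assumes "cond10 r s t k"
  shows "cube_index (four_blocks r s t k) = enat (2*k + s + 3)"
proof -
  have "int r = 1" "int t = 1" "int k + 1 \<le> int s" "1 \<le> int k"
    using assms by (simp_all add: cond10_def)
  from shift_count_cond10[OF this] show ?thesis
    by (rule cube_index_four_blocks[rotated 3]) (use assms in \<open>auto simp: cond10_def\<close>)
qed

lemma cube_index_cond11:
  assumes "cond11 r s t k"
  shows "cube_index (four_blocks r s t k) = enat (3*r + 2*s + k - 1)"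
proof -
  have "2 \<le> int r" "int t = int r" "int k + 1 \<le> int s" "1 \<le> int k"
    using assms by (simp_all add: cond11_def)
  from shift_count_cond11[OF this] show ?thesis
    by (rule cube_index_four_blocks[rotated 3]) (use assms in \<open>auto simp: cond11_def\<close>)
qed

lemma cube_index_cond12:
  assumes "cond12 r s t k"
  shows "cube_index (four_blocks r s t k) = enat (2*s + 2*t + r + k - 2)"
proof -
  have "1 \<le> int r" "int r + 2 \<le> int t" "int k + 2 \<le> int s" "1 \<le> int k"
    using assms by (simp_all add: cond12_def)
  from shift_count_cond12[OF this] show ?thesis
    by (rule cube_index_four_blocks[rotated 3]) (use assms in \<open>auto simp: cond12_def\<close>)
qed

lemma cube_index_cond13:
  assumes "cond13 r s t k"
  shows "cube_index (four_blocks r s t k) = enat (2*s + k + r + 4)"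
proof -
  have "1 \<le> int r" "int r \<le> 2" "int t = 2" "1 \<le> int s" "int s + 3 \<le> int k"
    using assms by (simp_all add: cond13_def)
  from shift_count_cond13[OF this] show ?thesis
    by (rule cube_index_four_blocks[rotated 3]) (use assms in \<open>auto simp: cond13_def\<close>)
qed

lemma cube_index_cond14:
  assumes "cond14 r s t k"
  shows "cube_index (four_blocks r s t k) = enat (2 * (r + s + t + k - 1))"
proof -
  from assms consider (a) "s + 3 \<le> k" "3 \<le> r" "t = 2" "1 \<le> s"
    | (b) "s + 3 \<le> k" "r = 3" "t = 1" "2 \<le> s"
    | (c) "s + 3 \<le> k" "t \<le> r" "3 \<le> t" "1 \<le> s"
    | (d) "s + 3 \<le> k" "3 \<le> r" "r + 1 \<le> t" "1 \<le> s"
    unfolding cond14_def by blast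
  then show ?thesis
  proof cases
    case a
    then have "int s + 3 \<le> int k" "3 \<le> int r" "int t = 2" "1 \<le> int s"
      by simp_all
    from shift_count_cond14_a[OF this] show ?thesis
      by (rule cube_index_four_blocks[rotated 3]) (use a in auto)
  next
    case b
    then have "int s + 3 \<le> int k" "int r = 3" "int t = 1" "2 \<le> int s"
      by simp_all
    from shift_count_cond14_b[OF this] show ?thesis
      by (rule cube_index_four_blocks[rotated 3]) (use b in auto)
  next
    case c
    then have "int s + 3 \<le> int k" "int t \<le> int r" "3 \<le> int t" "1 \<le> int s"
      by simp_all
    from shift_count_cond14_c[OF this] show ?thesis
      by (rule cube_index_four_blocks[rotated 3]) (use c in auto)
  next
    case d
    then have "int s + 3 \<le> int k" "3 \<le> int r" "int r + 1 \<le> int t" "1 \<le> int s"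
      by simp_all
    from shift_count_cond14_d[OF this] show ?thesis
      by (rule cube_index_four_blocks[rotated 3]) (use d in auto)
  qed
qed

lemma cube_index_cond15:
  assumes "cond15 r s t k"
  shows "cube_index (four_blocks r s t k) = enat (r + 2*s + 2*t + k + 2)"
proof -
  from assms consider (a) "2 \<le> r" "t = r + 1" "k + 1 \<le> s" "2 \<le> k"
    | (b) "r = t + 1" "1 \<le> t" "k \<le> s" "2 \<le> k"
    | (c) "r = t + 2" "1 \<le> t" "2 \<le> s" "k = s + 2"
    | (d) "r = t" "2 \<le> t" "2 \<le> s" "k = s"
    unfolding cond15_def by blast
  then show ?thesis
  proof cases
    case a
    then have "2 \<le> int r" "int t = int r + 1" "int k + 1 \<le> int s" "2 \<le> int k"
      by simp_all
    from shift_count_cond15_a[OF this] show ?thesis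
      by (rule cube_index_four_blocks[rotated 3]) (use a in auto)
  next
    case b
    then have "int r = int t + 1" "1 \<le> int t" "int k \<le> int s" "2 \<le> int k"
      by simp_all
    from shift_count_cond15_b[OF this] show ?thesis
      by (rule cube_index_four_blocks[rotated 3]) (use b in auto)
  next
    case c
    then have "int r = int t + 2" "1 \<le> int t" "2 \<le> int s" "int k = int s + 2"
      by simp_all
    from shift_count_cond15_c[OF this] show ?thesis
      by (rule cube_index_four_blocks[rotated 3]) (use c in auto)
  next
    case d
    then have "int r = int t" "2 \<le> int t" "2 \<le> int s" "int k = int s"
      by simp_all
    from shift_count_cond15_d[OF this] show ?thesis
      by (rule cube_index_four_blocks[rotated 3]) (use d in auto)
  qed
qed

theorem theorem1p2:
  fixes r s t k :: nat
  assumes "r \<ge> 1" and "s \<ge> 1" and "t \<ge> 1" and "k \<ge> 1"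
  shows
    "(map Not (rev (four_blocks r s t k)) = four_blocks k t s r) \<and>
     (cube_index (four_blocks k t s r) = cube_index (four_blocks r s t k)) \<and>
     (some_cond r s t k \<or> some_cond k t s r) \<and>
     (cond1 r s t k \<longrightarrow> cube_index (four_blocks r s t k) = \<infinity>) \<and>
     (cond2 r s t k \<longrightarrow> cube_index (four_blocks r s t k) = \<infinity>) \<and>
     (cond3 r s t k \<longrightarrow> cube_index (four_blocks r s t k) = \<infinity>) \<and>
     (cond4 r s t k \<longrightarrow> cube_index (four_blocks r s t k) = \<infinity>) \<and>
     (cond5 r s t k \<longrightarrow> cube_index (four_blocks r s t k) = enat (2*r + 2*s + t + 2)) \<and>
     (cond6 r s t k \<longrightarrow> cube_index (four_blocks r s t k) = enat (3*t + 2*s + k + 2)) \<and>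
     (cond7 r s t k \<longrightarrow> cube_index (four_blocks r s t k) = enat (2*r + 2*s + t + k - 1)) \<and>
     (cond8 r s t k \<longrightarrow> cube_index (four_blocks r s t k) = enat (r + 2*s + 2*t + k)) \<and>
     (cond9 r s t k \<longrightarrow> cube_index (four_blocks r s t k) = enat (2*s + k + 4)) \<and>
     (cond10 r s t k \<longrightarrow> cube_index (four_blocks r s t k) = enat (2*k + s + 3)) \<and>
     (cond11 r s t k \<longrightarrow> cube_index (four_blocks r s t k) = enat (3*r + 2*s + k - 1)) \<and>
     (cond12 r s t k \<longrightarrow> cube_index (four_blocks r s t k) = enat (2*s + 2*t + r + k - 2)) \<and>
     (cond13 r s t k \<longrightarrow> cube_index (four_blocks r s t k) = enat (2*s + k + r + 4)) \<and>
     (cond14 r s t k \<longrightarrow> cube_index (four_blocks r s t k) = enat (2 * (r + s + t + k - 1))) \<and>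
     (cond15 r s t k \<longrightarrow> cube_index (four_blocks r s t k) = enat (r + 2*s + 2*t + k + 2))"
proof -
  \<comment> \<open>The conditions are governed by \<open>r - t\<close> and \<open>k - s\<close>,
    which the passage to \<open>(k, t, s, r)\<close> exchanges; six ranges for each give 36
    cases.\<close>
  have "t + 3 \<le> r \<or> r = t + 2 \<or> r = t + 1 \<or> r = t \<or> t = r + 1 \<or> r + 2 \<le> t"
    "s + 3 \<le> k \<or> k = s + 2 \<or> k = s + 1 \<or> k = s \<or> s = k + 1 \<or> k + 2 \<le> s"
    by linarith+
  then have covered: "some_cond r s t k \<or> some_cond k t s r"
    using assms
    unfolding some_cond_def cond1_def cond2_def cond3_def cond4_def cond5_def cond6_def cond7_def
      cond8_def cond9_def cond10_def cond11_def cond12_def cond13_def cond14_def cond15_def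
    by (elim disjE; simp; presburger?)
  have symmetric: "cube_index (four_blocks k t s r) = cube_index (four_blocks r s t k)"
    using cube_index_map_Not_rev[of "four_blocks r s t k"] by (simp only: map_Not_rev_four_blocks)
  show ?thesis
    by (intro conjI impI map_Not_rev_four_blocks covered symmetric
      cube_index_cond1 cube_index_cond2 cube_index_cond3 cube_index_cond4 cube_index_cond5
      cube_index_cond6 cube_index_cond7 cube_index_cond8 cube_index_cond9 cube_index_cond10
      cube_index_cond11 cube_index_cond12 cube_index_cond13 cube_index_cond14 cube_index_cond15)
qed

end
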